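(* Consider the reset-button coupon collector described in the context, with arbitrary standard coupon probabilities. For each $n$, let $0<\rho_n<1$, $q_n=1-\rho_n$, let $C_n$ be the ordinary coupon collector completion time with probabilities $\pi_{i,n}=p_{i,n}/q_n$ (a positive integer-valued random variable) with probability generating function $\phi_n(z)=\mathbb E z^{C_n}$, and define $s_n:=\phi_n(q_n)=\mathbb E q_n^{C_n}$. Assume $s_n\to0$ and $\rho_nq_n\phi_n'(q_n)\to0$. Then $\rho_ns_nT_n\Rightarrow\mathrm{Exp}(1)$, and for every fixed integer $r\ge1$, $\mathbb E(\rho_ns_nT_n)^r\to r!$.
   Context: Reset-button collector: fix $n\ge1$. There are standard coupons $1,\dots,n$ and a reset coupon. At each discrete time $t=1,2,\dots$ one coupon is sampled independently: the reset coupon with probability $\rho_n\in(0,1)$, standard coupon $i$ with probability $p_{i,n}>0$, where $\sum_{i=1}^np_{i,n}=q_n:=1-\rho_n$. Starting from the empty collection, a standard coupon drawn is added to the collection; when the reset coupon appears the collection is emptied and collecting continues from the empty collection. $T_n$ is the first time at which all $n$ standard coupons are present. The ordinary coupon collector completion time $C_n$ with probabilities $\pi_{1,n},\dots,\pi_{n,n}$ is the number of i.i.d. draws from $[n]$ with these probabilities needed until every type has been seen. $\mathrm{Exp}(1)$ is the exponential law with mean 1. *)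

theory Defs
  imports "HOL-Probability.Probability"
begin

text \<open>Coupons: standard coupons are \<open>Some i\<close> with \<open>i < n\<close> (i.e. \<open>0..n-1\<close> instead of \<open>1..n\<close>),
  the reset coupon is \<open>None\<close>. The draw at time \<open>t+1\<close> is \<open>\<omega> !! t\<close>.\<close>

primrec collection :: "nat option stream \<Rightarrow> nat \<Rightarrow> nat set" where
  "collection \<omega> 0 = {}"
| "collection \<omega> (Suc t) =
     (case \<omega> !! t of None \<Rightarrow> {} | Some i \<Rightarrow> insert i (collection \<omega> t))"

definition reset_time :: "nat \<Rightarrow> nat option stream \<Rightarrow> nat" where
  "reset_time n \<omega> = (LEAST t. collection \<omega> t = {..<n})"

definition cc_time :: "nat \<Rightarrow> nat stream \<Rightarrow> nat" where
  "cc_time n \<omega> = (LEAST t. {..<n} \<subseteq> (\<lambda>k. \<omega> !! k) ` {..<t})"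

definition cc_pgf :: "nat \<Rightarrow> nat pmf \<Rightarrow> real \<Rightarrow> real" where
  "cc_pgf n P z = (\<integral>\<omega>. z ^ cc_time n \<omega> \<partial>stream_space (measure_pmf P))"

end

(* Conditioning on the first reset, T has generating function
   E z^T = (1 - q z) \<phi>(q z) / (1 - z + \<rho> z \<phi>(q z)).
   For z = exp(i t \<rho> s), one has |\<phi>(q z) - \<phi>(q)| \<le> |1 - z| q \<phi>'(q) = o(s), so
   after division by \<rho> s the right-hand side tends to 1 / (1 - i t), the characteristic function of
   Exp(1), and Levy's continuity theorem applies. For the moments, collecting from the empty set
   is slowest, hence P(T > a + b) \<le> P(T > a) P(T > b); together with E T \<le> 1 / (\<rho> s) this yields
   a uniform exponential tail for \<rho> s T, and dominated convergence in the layer-cake formula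
   E X^r = \<integral> r t^(r-1) P(X > t) dt finishes the proof. *)

theory Submission
  imports Defs
begin

section \<open>Hitting times of a process driven by independent draws\<close>

text \<open>Both collectors are folds over i.i.d. draws, so they share one survival function, and
  most of the probability is confined to its first-step recursion \<open>survival_Suc\<close>. What
  follows is largely algebra with the sequences \<open>h {}\<close> (reset collector) and
  \<open>g {}\<close> (ordinary collector). With tails instead of point masses, the first-reset
  decomposition becomes a renewal equation with kernel \<open>\<rho> * q ^ t * g {} t\<close>. Its
  total mass is \<open>1 - s\<close>, the probability that a reset precedes completion. Since
  \<open>s > 0\<close> the kernel is defective; this makes the tails summable, which gives almost
  sure finiteness and a finite mean, and it admits generating functions on the closed disc,
  including the unit circle needed for characteristic functions. Almost sure finiteness has to
  precede the statements on the laws of the times: they are \<open>LEAST\<close> values, arbitrary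
  on streams that never complete.\<close>

definition survival :: "'a::countable pmf \<Rightarrow> ('s \<Rightarrow> 'a \<Rightarrow> 's) \<Rightarrow> ('s \<Rightarrow> bool) \<Rightarrow> 's \<Rightarrow> nat \<Rightarrow> real" where
  "survival D f G x t =
     measure (stream_space (measure_pmf D)) {\<omega>. \<forall>k\<le>t. \<not> G (foldl f x (stake k \<omega>))}"

definition hitting_time :: "('s \<Rightarrow> 'a \<Rightarrow> 's) \<Rightarrow> ('s \<Rightarrow> bool) \<Rightarrow> 's \<Rightarrow> 'a stream \<Rightarrow> nat" where
  "hitting_time f G x \<omega> = (LEAST k. G (foldl f x (stake k \<omega>)))"

lemma space_stream_space_pmf [simp]: "space (stream_space (measure_pmf D)) = UNIV"
  by (simp add: space_stream_space)

lemma prob_space_stream_space_pmf: "prob_space (stream_space (measure_pmf D))"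
  by (rule prob_space.prob_space_stream_space) (rule measure_pmf.prob_space_axioms)

text \<open>Prefixes of length \<open>k\<close> lie in a countable type of lists, where every set is
  measurable; step function and target may thus be arbitrary.\<close>

lemma measurable_stake_pred [measurable]:
  fixes D :: "'a::countable pmf"
  shows "Measurable.pred (stream_space (measure_pmf D)) (\<lambda>\<omega>. P (stake k \<omega>))"
proof -
  have "stake k \<in> measurable (stream_space (measure_pmf D)) (count_space UNIV)"
    using measurable_stake[of k, where 'a='a]
    by (subst measurable_cong_sets[OF sets_stream_space_cong[of _ "count_space UNIV"] refl]) auto
  then show ?thesis by (rule measurable_compose) simp
qed

lemma measurable_hitting_time [measurable]:
  fixes D :: "'a::countable pmf"
  shows "hitting_time f G x \<in> measurable (stream_space (measure_pmf D)) (count_space UNIV)"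
  unfolding hitting_time_def[abs_def] by measurable

lemma survival_event [measurable, simp]:
  fixes D :: "'a::countable pmf"
  shows "{\<omega>. \<forall>k\<le>t. \<not> G (foldl f x (stake k \<omega>))} \<in> sets (stream_space (measure_pmf D))"
    "{\<omega>. \<forall>k. \<not> G (foldl f x (stake k \<omega>))} \<in> sets (stream_space (measure_pmf D))"
proof -
  have "{\<omega>\<in>space (stream_space (measure_pmf D)). \<forall>k\<le>t. \<not> G (foldl f x (stake k \<omega>))}
      \<in> sets (stream_space (measure_pmf D))"
    "{\<omega>\<in>space (stream_space (measure_pmf D)). \<forall>k. \<not> G (foldl f x (stake k \<omega>))}
      \<in> sets (stream_space (measure_pmf D))"
    by measurable
  then show "{\<omega>. \<forall>k\<le>t. \<not> G (foldl f x (stake k \<omega>))} \<in> sets (stream_space (measure_pmf D))"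
    "{\<omega>. \<forall>k. \<not> G (foldl f x (stake k \<omega>))} \<in> sets (stream_space (measure_pmf D))"
    by simp_all
qed

lemma hitting_time_event [measurable, simp]:
  fixes D :: "'a::countable pmf"
  shows "{\<omega>. P (hitting_time f G x \<omega>)} \<in> sets (stream_space (measure_pmf D))"
proof -
  have "{\<omega>\<in>space (stream_space (measure_pmf D)). P (hitting_time f G x \<omega>)}
      \<in> sets (stream_space (measure_pmf D))"
    by measurable
  then show ?thesis by simp
qed

lemma survival_bounds: "0 \<le> survival D f G x t" "survival D f G x t \<le> 1"
proof -
  interpret S: prob_space "stream_space (measure_pmf D)" by (rule prob_space_stream_space_pmf)
  show "0 \<le> survival D f G x t" "survival D f G x t \<le> 1"
    by (auto simp: survival_def)
qed

lemma survival_target: "G x \<Longrightarrow> survival D f G x t = 0"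
proof -
  assume "G x"
  then have "{\<omega>. \<forall>k\<le>t. \<not> G (foldl f x (stake k \<omega>))} = {}"
    by (auto intro!: exI[of _ 0])
  then show ?thesis unfolding survival_def by (simp only: measure_empty)
qed

lemma survival_0: "\<not> G x \<Longrightarrow> survival D f G x 0 = 1"
proof -
  interpret S: prob_space "stream_space (measure_pmf D)" by (rule prob_space_stream_space_pmf)
  assume "\<not> G x"
  then show ?thesis using S.prob_space by (simp add: survival_def)
qed

text \<open>First-step analysis. The hypothesis disposes of \<open>k = 0\<close>, so the constraint
  up to \<open>Suc t\<close> becomes one up to \<open>t\<close> started from
  \<open>f x y\<close>.\<close>

lemma survival_Suc:
  assumes "\<not> G x"
  shows "survival D f G x (Suc t) = (\<integral>y. survival D f G (f x y) t \<partial>measure_pmf D)"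
proof -
  have eq: "(\<forall>k\<le>Suc t. \<not> G (foldl f x (stake k (y ## \<omega>)))) \<longleftrightarrow>
      (\<forall>k\<le>t. \<not> G (foldl f (f x y) (stake k \<omega>)))" for y \<omega>
  proof
    assume *: "\<forall>k\<le>Suc t. \<not> G (foldl f x (stake k (y ## \<omega>)))"
    show "\<forall>k\<le>t. \<not> G (foldl f (f x y) (stake k \<omega>))"
    proof (intro allI impI)
      fix k assume "k \<le> t"
      with *[rule_format, of "Suc k"] show "\<not> G (foldl f (f x y) (stake k \<omega>))" by simp
    qed
  next
    assume *: "\<forall>k\<le>t. \<not> G (foldl f (f x y) (stake k \<omega>))"
    show "\<forall>k\<le>Suc t. \<not> G (foldl f x (stake k (y ## \<omega>)))"
    proof (intro allI impI)
      fix k assume "k \<le> Suc t"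
      with * assms show "\<not> G (foldl f x (stake k (y ## \<omega>)))" by (cases k) auto
    qed
  qed
  have "ennreal (survival D f G x (Suc t)) = (\<integral>\<^sup>+y. survival D f G (f x y) t \<partial>measure_pmf D)"
    using prob_space.prob_stream_space[OF measure_pmf.prob_space_axioms[of D], where P="\<lambda>\<omega>. \<forall>k\<le>Suc t. \<not> G (foldl f x (stake k \<omega>))"]
    by (simp add: survival_def eq del: stake.simps)
  also have "\<dots> = ennreal (\<integral>y. survival D f G (f x y) t \<partial>measure_pmf D)"
    by (intro nn_integral_eq_integral measure_pmf.integrable_const_bound[where B=1])
       (auto simp: survival_bounds)
  finally show ?thesis
    by (simp add: survival_bounds integral_nonneg)
qed

lemma survival_antimono: "survival D f G x (Suc t) \<le> survival D f G x t"
proof -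
  interpret S: prob_space "stream_space (measure_pmf D)" by (rule prob_space_stream_space_pmf)
  show ?thesis unfolding survival_def
    by (rule S.finite_measure_mono) auto
qed

text \<open>\<open>LEAST\<close> is arbitrary on the streams that never reach the target; the hypothesis makes
  these a null set.\<close>
lemma prob_hitting_time_gt:
  fixes D :: "'a::countable pmf"
  assumes "survival D f G x \<longlonglongrightarrow> 0"
  shows "measure (stream_space (measure_pmf D)) {\<omega>. t < hitting_time f G x \<omega>} = survival D f G x t"
proof -
  interpret S: prob_space "stream_space (measure_pmf D)" by (rule prob_space_stream_space_pmf)
  let ?hit = "\<lambda>k \<omega>. G (foldl f x (stake k \<omega>))"
  have "S.prob {\<omega>. \<forall>k. \<not> ?hit k \<omega>} \<le> survival D f G x j" for j
    unfolding survival_def by (rule S.finite_measure_mono) auto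
  then have "S.prob {\<omega>. \<forall>k. \<not> ?hit k \<omega>} \<le> 0"
    by (intro LIMSEQ_le_const[OF assms]) auto
  then have "S.prob {\<omega>. \<forall>k. \<not> ?hit k \<omega>} = 0"
    by (simp add: measure_le_0_iff)
  then have "AE \<omega> in stream_space (measure_pmf D). \<exists>k. ?hit k \<omega>"
    by (subst (asm) S.prob_eq_0) auto
  then show ?thesis
    unfolding survival_def
  proof (intro S.finite_measure_eq_AE)
    assume "AE \<omega> in stream_space (measure_pmf D). \<exists>k. ?hit k \<omega>"
    then show "AE \<omega> in stream_space (measure_pmf D). (\<omega> \<in> {\<omega>. t < hitting_time f G x \<omega>}) =
        (\<omega> \<in> {\<omega>. \<forall>k\<le>t. \<not> ?hit k \<omega>})"
    proof eventually_elim
      case (elim \<omega>)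
      then have "?hit (hitting_time f G x \<omega>) \<omega>"
        unfolding hitting_time_def by (rule LeastI_ex)
      moreover have "\<not> ?hit k \<omega>" if "k < hitting_time f G x \<omega>" for k
        using that unfolding hitting_time_def by (rule not_less_Least)
      ultimately show ?case by (auto simp flip: not_le)
    qed
  qed auto
qed

section \<open>Probability generating functions of integer-valued times\<close>

lemma (in prob_space) pgf_sums:
  fixes X :: "'a \<Rightarrow> nat" and z :: "'b::{real_normed_field,banach,second_countable_topology}"
  assumes [measurable]: "X \<in> measurable M (count_space UNIV)" and z: "norm z \<le> 1"
  shows "(\<lambda>m. of_real (prob {\<omega>\<in>space M. X \<omega> = m}) * z ^ m) sums (\<integral>\<omega>. z ^ X \<omega> \<partial>M)"
proof -
  \<comment> \<open>\<open>F m\<close> is the part of \<open>z ^ X\<close> on the event that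
    \<open>X\<close> equals \<open>m\<close>. Series and integral may be exchanged because the norms
    integrate to at most the point probabilities, which are summable.\<close>
  define F where "F m \<omega> = (if X \<omega> = m then z ^ m else 0)" for m \<omega>
  have F: "F m \<omega> = indicator {\<omega>\<in>space M. X \<omega> = m} \<omega> *\<^sub>R z ^ m" if "\<omega> \<in> space M" for m \<omega>
    using that by (auto simp: F_def)
  have hbi: "has_bochner_integral M (F m) (prob {\<omega>\<in>space M. X \<omega> = m} *\<^sub>R z ^ m)" for m
    by (subst has_bochner_integral_cong[OF refl F refl], assumption)
       (auto intro!: has_bochner_integral_scaleR_left has_bochner_integral_real_indicator
             simp: less_top[symmetric])
  have int: "integrable M (F m)" for m
    using hbi by (rule integrable.intros)
  have intF: "(\<integral>\<omega>. F m \<omega> \<partial>M) = of_real (prob {\<omega>\<in>space M. X \<omega> = m}) * z ^ m" for m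
    using has_bochner_integral_integral_eq[OF hbi[of m]] by (simp add: scaleR_conv_of_real)
  have intnF: "(\<integral>\<omega>. norm (F m \<omega>) \<partial>M) = prob {\<omega>\<in>space M. X \<omega> = m} * norm z ^ m" for m
  proof -
    have "(\<integral>\<omega>. norm (F m \<omega>) \<partial>M) = (\<integral>\<omega>. indicator {\<omega>\<in>space M. X \<omega> = m} \<omega> *\<^sub>R norm z ^ m \<partial>M)"
      by (rule Bochner_Integration.integral_cong[OF refl]) (auto simp: F_def norm_power)
    then show ?thesis by simp
  qed
  have "(\<lambda>m. prob {\<omega>\<in>space M. X \<omega> = m}) sums prob (\<Union>m. {\<omega>\<in>space M. X \<omega> = m})"
    by (rule finite_measure_UNION) (auto simp: disjoint_family_on_def)
  then have sp: "summable (\<lambda>m. prob {\<omega>\<in>space M. X \<omega> = m})" by (rule sums_summable)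
  have Fs: "(\<lambda>m. F m \<omega>) sums z ^ X \<omega>" for \<omega>
    using sums_single[of "X \<omega>" "\<lambda>m. z ^ m"] by (simp add: F_def eq_commute)
  have "(\<lambda>m. \<integral>\<omega>. F m \<omega> \<partial>M) sums (\<integral>\<omega>. (\<Sum>m. F m \<omega>) \<partial>M)"
  proof (rule sums_integral[OF int])
    show "AE \<omega> in M. summable (\<lambda>m. norm (F m \<omega>))"
    proof (rule AE_I2)
      fix \<omega> show "summable (\<lambda>m. norm (F m \<omega>))"
        by (rule summable_finite[of "{X \<omega>}"]) (auto simp: F_def)
    qed
    show "summable (\<lambda>m. \<integral>\<omega>. norm (F m \<omega>) \<partial>M)"
      unfolding intnF
      by (rule summable_comparison_test'[OF sp, of 0])
         (use z in \<open>auto simp: power_le_one mult_left_le\<close>)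
  qed
  moreover have "(\<Sum>m. F m \<omega>) = z ^ X \<omega>" for \<omega>
    using Fs[of \<omega>] by (rule sums_unique[symmetric])
  ultimately show ?thesis by (simp add: intF)
qed

lemma hitting_time_pgf_sums:
  fixes D :: "'a::countable pmf" and z :: "'b::{real_normed_field,banach,second_countable_topology}"
  assumes lim: "survival D f G x \<longlonglongrightarrow> 0" and "\<not> G x" and z: "norm z \<le> 1"
  shows "(\<lambda>m. of_real (survival D f G x m - survival D f G x (Suc m)) * z ^ Suc m)
           sums (\<integral>\<omega>. z ^ hitting_time f G x \<omega> \<partial>stream_space (measure_pmf D))"
proof -
  interpret S: prob_space "stream_space (measure_pmf D)" by (rule prob_space_stream_space_pmf)
  let ?T = "hitting_time f G x"
  have gt: "S.prob {\<omega>. t < ?T \<omega>} = survival D f G x t" for t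
    by (rule prob_hitting_time_gt[OF lim])
  \<comment> \<open>The start is outside the target, so time 0 has no mass and the series begins
    with exponent 1.\<close>
  have "S.prob {\<omega>. ?T \<omega> = 0} = 1 - S.prob {\<omega>. 0 < ?T \<omega>}"
    using S.prob_compl[of "{\<omega>. 0 < ?T \<omega>}"] by (simp add: Collect_neg_eq[symmetric] Compl_eq_Diff_UNIV[symmetric])
  then have 0: "S.prob {\<omega>. ?T \<omega> = 0} = 0"
    using survival_0[of G x D f] assms(2) by (simp add: gt)
  have Suc: "S.prob {\<omega>. ?T \<omega> = Suc m} = survival D f G x m - survival D f G x (Suc m)" for m
  proof -
    have "S.prob ({\<omega>. m < ?T \<omega>} - {\<omega>. Suc m < ?T \<omega>}) = S.prob {\<omega>. m < ?T \<omega>} - S.prob {\<omega>. Suc m < ?T \<omega>}"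
      by (rule S.finite_measure_Diff) auto
    moreover have "{\<omega>. m < ?T \<omega>} - {\<omega>. Suc m < ?T \<omega>} = {\<omega>. ?T \<omega> = Suc m}" by auto
    ultimately show ?thesis by (simp add: gt)
  qed
  have "(\<lambda>m. of_real (S.prob {\<omega>. ?T \<omega> = m}) * z ^ m) sums (\<integral>\<omega>. z ^ ?T \<omega> \<partial>stream_space (measure_pmf D))"
    using S.pgf_sums[of ?T z] z by simp
  then show ?thesis
    using sums_Suc_iff[of "\<lambda>m. of_real (S.prob {\<omega>. ?T \<omega> = m}) * z ^ m"
        "\<integral>\<omega>. z ^ ?T \<omega> \<partial>stream_space (measure_pmf D)"]
    by (simp add: 0 Suc del: power_Suc)
qed

section \<open>Renewal sequences\<close>

text \<open>A partial sum \<open>S\<close> of \<open>u\<close> satisfies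
  \<open>S \<le> suminf b + r * suminf b * S\<close>. Being finite, \<open>S\<close> can be solved
  for, and the defect turns this into a bound independent of the truncation.\<close>

lemma renewal_summable:
  fixes u b :: "nat \<Rightarrow> real"
  assumes u: "\<And>t. u t = b t + r * (\<Sum>k<t. b k * u (t - Suc k))"
    and nonneg: "\<And>t. 0 \<le> u t" "\<And>t. 0 \<le> b t" "0 \<le> r"
    and b: "summable b" and defect: "r * suminf b < 1"
  shows "summable u"
proof (rule summableI_nonneg_bounded[OF nonneg(1)])
  fix N
  let ?S = "\<Sum>t\<le>N. u t"
  have bN: "(\<Sum>k\<in>I. b k) \<le> suminf b" if "finite I" for I
    using b nonneg that by (intro sum_le_suminf) auto
  have "(\<Sum>t\<le>N. \<Sum>k<t. b k * u (t - Suc k)) = (\<Sum>k<N. b k * (\<Sum>t=Suc k..N. u (t - Suc k)))"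
    by (simp add: sum.nested_swap' sum_distrib_left)
  also have "\<dots> \<le> (\<Sum>k<N. b k * ?S)"
  proof (intro sum_mono mult_left_mono nonneg)
    fix k
    show "(\<Sum>t=Suc k..N. u (t - Suc k)) \<le> ?S"
      by (rule sum_le_included[where i="\<lambda>t. t + Suc k"]) (auto simp: nonneg intro!: bexI[of _ "_ - Suc k"])
  qed
  also have "\<dots> \<le> suminf b * ?S"
    unfolding sum_distrib_right[symmetric] by (intro mult_right_mono bN sum_nonneg nonneg) auto
  finally have "(\<Sum>t\<le>N. \<Sum>k<t. b k * u (t - Suc k)) \<le> suminf b * ?S" .
  then have "r * (\<Sum>t\<le>N. \<Sum>k<t. b k * u (t - Suc k)) \<le> r * (suminf b * ?S)"
    by (rule mult_left_mono) (rule nonneg)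
  moreover have "?S = (\<Sum>t\<le>N. b t) + r * (\<Sum>t\<le>N. \<Sum>k<t. b k * u (t - Suc k))"
    by (subst u) (simp add: sum.distrib sum_distrib_left)
  ultimately have "?S * (1 - r * suminf b) \<le> suminf b"
    using bN[of "{..N}"] by (simp add: algebra_simps)
  then have "?S \<le> suminf b / (1 - r * suminf b)"
    using defect by (simp add: field_simps)
  moreover have "(\<Sum>t<N. u t) \<le> ?S"
    by (rule sum_mono2) (auto simp: nonneg)
  ultimately show "(\<Sum>t<N. u t) \<le> suminf b / (1 - r * suminf b)" by simp
qed

lemma summable_norm_weighted:
  fixes z :: "'b::{real_normed_field,banach}"
  assumes "summable u" "\<And>t. 0 \<le> u t" "norm z \<le> 1"
  shows "summable (\<lambda>t. norm (of_real (u t) * z ^ t))"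
  by (rule summable_comparison_test'[OF assms(1), of 0])
     (use assms in \<open>auto simp: norm_mult norm_power power_le_one mult_left_le\<close>)

text \<open>The convolution becomes a Cauchy product. Summability of \<open>u\<close> justifies this
  on the boundary \<open>norm z = 1\<close>.\<close>

lemma renewal_gf:
  fixes u b :: "nat \<Rightarrow> real" and z :: "'b::{real_normed_field,banach}"
  assumes u: "\<And>t. u t = b t + r * (\<Sum>k<t. b k * u (t - Suc k))"
    and nonneg: "\<And>t. 0 \<le> u t" "\<And>t. 0 \<le> b t"
    and b: "summable b" and su: "summable u" and z: "norm z \<le> 1"
  defines "B \<equiv> \<Sum>t. of_real (b t) * z ^ t" and "U \<equiv> \<Sum>t. of_real (u t) * z ^ t"
  shows "U = B + of_real r * z * B * U"
proof -
  define f where "f t = z ^ t * of_real (r * (\<Sum>k<t. b k * u (t - Suc k)))" for t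
  note nb = summable_norm_weighted[OF b nonneg(2) z] and nu = summable_norm_weighted[OF su nonneg(1) z]
  have "(\<lambda>n. \<Sum>i\<le>n. (of_real (b i) * z ^ i) * (of_real (u (n - i)) * z ^ (n - i))) sums (B * U)"
    unfolding B_def U_def by (rule Cauchy_product_sums[OF nb nu])
  then have "(\<lambda>n. of_real r * z * (\<Sum>i\<le>n. (of_real (b i) * z ^ i) * (of_real (u (n - i)) * z ^ (n - i))))
      sums (of_real r * z * (B * U))"
    by (rule sums_mult)
  also have "(\<lambda>n. of_real r * z * (\<Sum>i\<le>n. (of_real (b i) * z ^ i) * (of_real (u (n - i)) * z ^ (n - i))))
      = (\<lambda>n. f (Suc n))"
  proof
    fix n
    have "(\<Sum>i\<le>n. (of_real (b i) * z ^ i) * (of_real (u (n - i)) * z ^ (n - i))) =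
        (\<Sum>i\<le>n. z ^ n * of_real (b i * u (n - i)))"
    proof (rule sum.cong[OF refl])
      fix i assume "i \<in> {..n}"
      then have "z ^ n = z ^ i * z ^ (n - i)" by (simp flip: power_add)
      then show "(of_real (b i) * z ^ i) * (of_real (u (n - i)) * z ^ (n - i)) = z ^ n * of_real (b i * u (n - i))"
        by simp
    qed
    then show "of_real r * z * (\<Sum>i\<le>n. (of_real (b i) * z ^ i) * (of_real (u (n - i)) * z ^ (n - i))) = f (Suc n)"
      by (simp add: f_def sum_distrib_left[symmetric] lessThan_Suc_atMost of_real_sum mult_ac)
  qed
  finally have "f sums (of_real r * z * (B * U))"
    by (subst (asm) sums_Suc_iff) (simp add: f_def)
  moreover have "(\<lambda>t. of_real (b t) * z ^ t) sums B"
    unfolding B_def using summable_norm_cancel[OF nb] by (rule summable_sums)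
  ultimately have "(\<lambda>t. of_real (b t) * z ^ t + f t) sums (B + of_real r * z * (B * U))"
    by (intro sums_add)
  moreover have "of_real (b t) * z ^ t + f t = of_real (u t) * z ^ t" for t
    by (subst u) (simp add: f_def algebra_simps)
  ultimately show ?thesis
    unfolding U_def by (simp add: sums_iff mult.assoc)
qed

text \<open>Summation by parts. For survival probabilities \<open>u\<close> the left side is the
  generating function of the hitting time, so this converts tails into point masses.\<close>

lemma increments_gf:
  fixes u :: "nat \<Rightarrow> real" and z :: "'b::real_normed_field"
  assumes "u 0 = 1" and "(\<lambda>t. of_real (u t) * z ^ t) sums U"
  shows "(\<lambda>m. of_real (u m - u (Suc m)) * z ^ Suc m) sums (1 - (1 - z) * U)"
proof -
  have "(\<lambda>m. of_real (u (Suc m)) * z ^ Suc m) sums (U - 1)"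
    using assms by (subst sums_Suc_iff) simp
  moreover have "(\<lambda>m. z * (of_real (u m) * z ^ m)) sums (z * U)"
    using assms(2) by (rule sums_mult)
  ultimately have "(\<lambda>m. z * (of_real (u m) * z ^ m) - of_real (u (Suc m)) * z ^ Suc m) sums (z * U - (U - 1))"
    by (intro sums_diff)
  then show ?thesis by (simp add: algebra_simps)
qed

section \<open>Survival probabilities of the two collectors\<close>

definition reset_step :: "nat set \<Rightarrow> nat option \<Rightarrow> nat set" where
  "reset_step X y = (case y of None \<Rightarrow> {} | Some i \<Rightarrow> insert i X)"

lemma collection_eq_foldl: "collection \<omega> t = foldl reset_step {} (stake t \<omega>)"
  by (induction t) (simp_all add: stake_Suc reset_step_def[abs_def] cong: option.case_cong del: stake.simps(2))

lemma reset_time_eq: "reset_time n = hitting_time reset_step (\<lambda>X. X = {..<n}) {}"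
  by (simp add: fun_eq_iff reset_time_def hitting_time_def collection_eq_foldl)

lemma foldl_insert: "foldl (\<lambda>X i. insert i X) X xs = X \<union> set xs"
  by (induction xs arbitrary: X) auto

lemma cc_time_eq: "cc_time n = hitting_time (\<lambda>X i. insert i X) (\<lambda>X. {..<n} \<subseteq> X) {}"
proof -
  have "set (stake t \<omega>) = (\<lambda>k. \<omega> !! k) ` {..<t}" for t and \<omega> :: "nat stream"
    by (induction t) (simp_all add: stake_Suc lessThan_Suc del: stake.simps(2))
  then show ?thesis
    by (simp add: fun_eq_iff cc_time_def hitting_time_def foldl_insert)
qed

locale reset_collector =
  fixes n :: nat and \<rho> :: real and p :: "nat \<Rightarrow> real" and D :: "nat option pmf" and P :: "nat pmf"
  assumes n: "n \<ge> 1" and rho: "0 < \<rho>" "\<rho> < 1"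
    and p_pos: "\<And>i. i < n \<Longrightarrow> p i > 0" and p_sum: "(\<Sum>i<n. p i) = 1 - \<rho>"
    and D_reset: "pmf D None = \<rho>" and D_std: "\<And>i. i < n \<Longrightarrow> pmf D (Some i) = p i"
    and P_def: "\<And>i. i < n \<Longrightarrow> pmf P i = p i / (1 - \<rho>)"
begin

abbreviation q :: real where "q \<equiv> 1 - \<rho>"

text \<open>Each target copies the definition of its time: equality for \<open>reset_time\<close>,
  inclusion for \<open>cc_time\<close>. Because of the equality, comparisons of \<open>h\<close> are
  stated for collections inside \<open>{..<n}\<close>.\<close>

abbreviation h :: "nat set \<Rightarrow> nat \<Rightarrow> real" where
  "h \<equiv> survival D reset_step (\<lambda>X. X = {..<n})"

abbreviation g :: "nat set \<Rightarrow> nat \<Rightarrow> real" where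
  "g \<equiv> survival P (\<lambda>X i. insert i X) (\<lambda>X. {..<n} \<subseteq> X)"

lemma set_pmf_D: "set_pmf D \<subseteq> insert None (Some ` {..<n})"
proof -
  have "measure_pmf.prob D (insert None (Some ` {..<n})) = \<rho> + (\<Sum>i<n. p i)"
    by (subst measure_measure_pmf_finite) (auto simp: sum.reindex D_reset D_std)
  then have "measure_pmf.prob D (insert None (Some ` {..<n})) = 1" by (simp add: p_sum)
  then show ?thesis
    by (subst (asm) measure_pmf.prob_eq_1) (auto simp: AE_measure_pmf_iff)
qed

lemma sum_P: "(\<Sum>i<n. pmf P i) = 1"
proof -
  have "(\<Sum>i<n. pmf P i) = (\<Sum>i<n. p i) / q"
    by (simp add: P_def sum_divide_distrib)
  then show ?thesis using rho by (simp add: p_sum)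
qed

lemma set_pmf_P: "set_pmf P \<subseteq> {..<n}"
proof -
  have "measure_pmf.prob P {..<n} = 1"
    by (subst measure_measure_pmf_finite) (auto simp: sum_P)
  then show ?thesis
    by (subst (asm) measure_pmf.prob_eq_1) (auto simp: AE_measure_pmf_iff)
qed

lemma integral_D: "(\<integral>y. f y \<partial>measure_pmf D) = \<rho> * f None + (\<Sum>i<n. p i * f (Some i))" for f :: "_ \<Rightarrow> real"
  using set_pmf_D
  by (subst integral_measure_pmf[of "insert None (Some ` {..<n})"])
     (auto simp: sum.reindex D_reset D_std)

lemma integral_P: "(\<integral>y. f y \<partial>measure_pmf P) = (\<Sum>i<n. pmf P i * f i)" for f :: "_ \<Rightarrow> real"
  using set_pmf_P by (subst integral_measure_pmf[of "{..<n}"]) auto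

lemma h_Suc:
  "X \<noteq> {..<n} \<Longrightarrow> h X (Suc t) = \<rho> * h {} t + (\<Sum>i<n. p i * h (insert i X) t)"
  by (subst survival_Suc) (simp_all add: integral_D reset_step_def)

lemma g_Suc:
  "\<not> {..<n} \<subseteq> X \<Longrightarrow> g X (Suc t) = (\<Sum>i<n. pmf P i * g (insert i X) t)"
  by (subst survival_Suc) (simp_all add: integral_P)

text \<open>Decomposition according to the time \<open>k + 1\<close> of the first reset.\<close>
lemma renewal_from:
  assumes "X \<subseteq> {..<n}"
  shows "h X t = q ^ t * g X t + \<rho> * (\<Sum>k<t. q ^ k * g X k * h {} (t - Suc k))"
  using assms
proof (induction t arbitrary: X)
  case 0
  then show ?case
    by (cases "X = {..<n}") (auto simp: survival_0 survival_target)
next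
  case (Suc t)
  show ?case
  proof (cases "X = {..<n}")
    case True
    then show ?thesis by (simp add: survival_target)
  next
    case False
    then have nX: "\<not> {..<n} \<subseteq> X" using Suc.prems by auto
    have ins: "insert i X \<subseteq> {..<n}" if "i < n" for i using that Suc.prems by auto
    have pq: "p i = q * pmf P i" if "i < n" for i using that rho by (simp add: P_def)
    have "(\<Sum>i<n. p i * h (insert i X) t) =
        (\<Sum>i<n. q * pmf P i * (q ^ t * g (insert i X) t)
             + (\<Sum>k<t. q * pmf P i * (\<rho> * (q ^ k * g (insert i X) k * h {} (t - Suc k)))))"
      by (intro sum.cong refl) (simp add: Suc.IH[OF ins] pq distrib_left sum_distrib_left)
    also have "\<dots> = q ^ Suc t * g X (Suc t) + (\<Sum>i<n. \<Sum>k<t. q * pmf P i * (\<rho> * (q ^ k * g (insert i X) k * h {} (t - Suc k))))"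
      by (simp add: g_Suc[OF nX] sum.distrib sum_distrib_left mult_ac)
    also have "(\<Sum>i<n. \<Sum>k<t. q * pmf P i * (\<rho> * (q ^ k * g (insert i X) k * h {} (t - Suc k)))) =
        (\<Sum>k<t. \<rho> * (q ^ Suc k * g X (Suc k) * h {} (t - Suc k)))"
      by (subst sum.swap) (simp add: g_Suc[OF nX] sum_distrib_left sum_distrib_right mult_ac)
    finally have "h X (Suc t) = q ^ Suc t * g X (Suc t) + \<rho> * (h {} t + (\<Sum>k<t. q ^ Suc k * g X (Suc k) * h {} (t - Suc k)))"
      by (simp add: h_Suc[OF False] distrib_left sum_distrib_left)
    \<comment> \<open>This value supplies the summand \<open>k = 0\<close>, a reset at the very
      first draw, which \<open>h_Suc\<close> shows as the bare term
      \<open>\<rho> * h {} t\<close>.\<close>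
    moreover have "g X 0 = 1" using nX by (rule survival_0)
    ultimately show ?thesis by (simp add: sum.lessThan_Suc_shift del: sum.lessThan_Suc power_Suc)
  qed
qed

section \<open>Dependence on the initial collection, and tail inequalities\<close>

lemma h_antimono: "X \<subseteq> Y \<Longrightarrow> Y \<subseteq> {..<n} \<Longrightarrow> h Y t \<le> h X t"
proof (induction t arbitrary: X Y)
  case 0
  then show ?case
    by (cases "Y = {..<n}"; cases "X = {..<n}") (auto simp: survival_0 survival_target survival_bounds)
next
  case (Suc t)
  show ?case
  proof (cases "Y = {..<n}")
    case True
    then show ?thesis by (simp add: survival_target survival_bounds)
  next
    case False
    with Suc.prems have "X \<noteq> {..<n}" by auto
    \<comment> \<open>Both collections receive the same draw: a standard coupon preserves the
      inclusion, and a reset makes them equal.\<close>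
    have "h (insert i Y) t \<le> h (insert i X) t" if "i < n" for i
      using that Suc.prems by (intro Suc.IH) auto
    then have "(\<Sum>i<n. p i * h (insert i Y) t) \<le> (\<Sum>i<n. p i * h (insert i X) t)"
      using p_pos by (intro sum_mono mult_left_mono) (auto intro: less_imp_le)
    then show ?thesis
      by (simp add: h_Suc[OF False] h_Suc[OF \<open>X \<noteq> {..<n}\<close>])
  qed
qed

text \<open>Starting from the empty collection is the slowest, so restarting the process from it at time
  \<open>s\<close> only increases the survival probability.\<close>
lemma h_add: "X \<subseteq> {..<n} \<Longrightarrow> h X (s + t) \<le> h X s * h {} t"
proof (induction s arbitrary: X)
  case 0
  then show ?case
    using h_antimono[of "{}" X t] by (cases "X = {..<n}") (auto simp: survival_0 survival_target)
next
  case (Suc s)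
  show ?case
  proof (cases "X = {..<n}")
    case True
    then show ?thesis by (simp add: survival_target)
  next
    case False
    have "h (insert i X) (s + t) \<le> h (insert i X) s * h {} t" if "i < n" for i
      using that Suc.prems by (intro Suc.IH) auto
    then have "(\<Sum>i<n. p i * h (insert i X) (s + t)) \<le> (\<Sum>i<n. p i * (h (insert i X) s * h {} t))"
      using p_pos by (intro sum_mono mult_left_mono) (auto intro: less_imp_le)
    moreover have "\<rho> * h {} (s + t) \<le> \<rho> * (h {} s * h {} t)"
      using rho Suc.IH[of "{}"] by simp
    ultimately show ?thesis
      by (simp add: h_Suc[OF False] distrib_right sum_distrib_right mult.assoc)
  qed
qed

lemma h_mult: "h {} (j * t) \<le> h {} t ^ j"
proof (induction j)
  case 0
  then show ?case by (simp add: survival_bounds)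
next
  case (Suc j)
  have "h {} (Suc j * t) \<le> h {} t * h {} (j * t)"
    using h_add[of "{}" t "j * t"] by simp
  also have "\<dots> \<le> h {} t * h {} t ^ j"
    by (intro mult_left_mono Suc.IH survival_bounds)
  finally show ?case by simp
qed

text \<open>Coupon \<open>i\<close> is missed by \<open>t\<close> draws with probability
  \<open>(1 - pmf P i) ^ t\<close>; the union bound is run along the recursion. A first draw
  \<open>j\<close> deletes the summand \<open>i = j\<close>, and the other weights of
  \<open>j\<close> add up to \<open>1 - pmf P i\<close>.\<close>

lemma g_union_bound: "X \<subseteq> {..<n} \<Longrightarrow> g X t \<le> (\<Sum>i\<in>{..<n} - X. (1 - pmf P i) ^ t)"
proof (induction t arbitrary: X)
  case 0
  show ?case
  proof (cases "X = {..<n}")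
    case False
    with 0 have "card ({..<n} - X) \<noteq> 0" by auto
    then have "1 \<le> real (card ({..<n} - X))" by linarith
    then show ?thesis
      using survival_bounds(2)[of P "\<lambda>X i. insert i X" "\<lambda>X. {..<n} \<subseteq> X" X 0] by simp
  qed (simp add: survival_target)
next
  case (Suc t)
  show ?case
  proof (cases "X = {..<n}")
    case True
    then show ?thesis by (simp add: survival_target)
  next
    case False
    then have nX: "\<not> {..<n} \<subseteq> X" using Suc.prems by auto
    have "g X (Suc t) \<le> (\<Sum>j<n. pmf P j * (\<Sum>i\<in>{..<n} - insert j X. (1 - pmf P i) ^ t))"
      unfolding g_Suc[OF nX] using Suc.prems by (intro sum_mono mult_left_mono Suc.IH) auto
    also have "\<dots> = (\<Sum>j<n. \<Sum>i\<in>{..<n} - X. if i = j then 0 else pmf P j * (1 - pmf P i) ^ t)"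
    proof (rule sum.cong[OF refl])
      fix j
      show "pmf P j * (\<Sum>i\<in>{..<n} - insert j X. (1 - pmf P i) ^ t) =
          (\<Sum>i\<in>{..<n} - X. if i = j then 0 else pmf P j * (1 - pmf P i) ^ t)"
        unfolding sum_distrib_left
        by (rule sum.mono_neutral_cong_left) auto
    qed
    also have "\<dots> = (\<Sum>i\<in>{..<n} - X. \<Sum>j<n. if i = j then 0 else pmf P j * (1 - pmf P i) ^ t)"
      by (rule sum.swap)
    also have "\<dots> = (\<Sum>i\<in>{..<n} - X. (1 - pmf P i) ^ Suc t)"
    proof (rule sum.cong[OF refl])
      fix i assume "i \<in> {..<n} - X"
      then have i: "i \<in> {..<n}" by simp
      have "(\<Sum>j<n. if i = j then 0 else pmf P j * (1 - pmf P i) ^ t) =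
          (\<Sum>j\<in>{..<n} - {i}. pmf P j * (1 - pmf P i) ^ t)"
        by (rule sum.mono_neutral_cong_right) auto
      also have "\<dots> = (\<Sum>j\<in>{..<n} - {i}. pmf P j) * (1 - pmf P i) ^ t"
        by (simp add: sum_distrib_right)
      also have "(\<Sum>j\<in>{..<n} - {i}. pmf P j) = 1 - pmf P i"
        using sum.remove[of "{..<n}" i "pmf P"] i by (simp add: sum_P)
      finally show "(\<Sum>j<n. if i = j then 0 else pmf P j * (1 - pmf P i) ^ t) = (1 - pmf P i) ^ Suc t"
        by simp
    qed
    finally show ?thesis .
  qed
qed

lemma g_tendsto_0: "g {} \<longlonglongrightarrow> 0"
proof (rule tendsto_sandwich[OF _ _ tendsto_const])
  show "\<forall>\<^sub>F t in sequentially. 0 \<le> g {} t" by (simp add: survival_bounds)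
  show "\<forall>\<^sub>F t in sequentially. g {} t \<le> (\<Sum>i<n. (1 - pmf P i) ^ t)"
    using g_union_bound[of "{}"] by simp
  have "(\<lambda>t. (1 - pmf P i) ^ t) \<longlonglongrightarrow> 0" if "i < n" for i
    using p_pos[OF that] rho that pmf_le_1[of P i]
    by (intro LIMSEQ_power_zero) (auto simp: P_def)
  then show "(\<lambda>t. \<Sum>i<n. (1 - pmf P i) ^ t) \<longlonglongrightarrow> 0"
    by (intro tendsto_null_sum) auto
qed

end

section \<open>Generating functions and tails for fixed parameters\<close>

context reset_collector
begin

definition s :: real where "s = cc_pgf n P q"

definition d :: real where "d = deriv (cc_pgf n P) q"

text \<open>\<open>c m\<close> is the probability that the ordinary collector needs \<open>m + 1\<close> draws.\<close>
definition c :: "nat \<Rightarrow> real" where "c m = g {} m - g {} (Suc m)"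

text \<open>Probability that \<open>t\<close> draws contain no reset and leave the collection
  incomplete; up to the factor \<open>\<rho>\<close>, the renewal kernel.\<close>

definition b :: "nat \<Rightarrow> real" where "b t = q ^ t * g {} t"

lemma start_incomplete: "{} \<noteq> {..<n}" "\<not> {..<n} \<subseteq> {}"
proof -
  have "{..<n} \<noteq> {}" using n by (simp add: lessThan_empty_iff)
  then show "{} \<noteq> {..<n}" "\<not> {..<n} \<subseteq> {}" by auto
qed

lemma g_0: "g {} 0 = 1" and h_0: "h {} 0 = 1"
  using start_incomplete by (auto intro!: survival_0)

lemma c_nonneg: "0 \<le> c m"
  by (simp add: c_def survival_antimono)

lemma c_sums: "c sums 1"
  using telescope_sums'[OF g_tendsto_0] by (simp add: c_def[abs_def] g_0)

lemma cc_pgf_sums: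
  fixes z :: "'b::{real_normed_field,banach,second_countable_topology}"
  assumes "norm z \<le> 1"
  shows "(\<lambda>m. of_real (c m) * z ^ Suc m) sums (\<integral>\<omega>. z ^ cc_time n \<omega> \<partial>stream_space (measure_pmf P))"
  unfolding c_def cc_time_eq
  by (rule hitting_time_pgf_sums[OF g_tendsto_0 start_incomplete(2) assms])

lemma cc_pgf_real_sums: "\<bar>z\<bar> \<le> 1 \<Longrightarrow> (\<lambda>m. c m * z ^ Suc m) sums cc_pgf n P z"
  using cc_pgf_sums[of z] by (simp add: cc_pgf_def)

lemma s_sums: "(\<lambda>m. c m * q ^ Suc m) sums s"
  using cc_pgf_real_sums[of q] rho by (simp add: s_def)

text \<open>The \<open>c m\<close> sum to 1, so one of them is positive, and \<open>q > 0\<close>.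
  Positivity of \<open>s\<close> makes the renewal kernel defective.\<close>

lemma s_pos: "0 < s"
proof -
  have "\<exists>m. c m \<noteq> 0"
  proof (rule ccontr)
    assume "\<nexists>m. c m \<noteq> 0"
    then have "c = (\<lambda>_. 0)" by auto
    with c_sums sums_unique2[of "\<lambda>_. 0::real" 0 1] show False by auto
  qed
  then obtain m where "c m > 0" using c_nonneg by (metis less_eq_real_def)
  then have "0 < (\<Sum>m. c m * q ^ Suc m)"
    using rho s_sums
    by (intro suminf_pos2[of _ m]) (auto simp: sums_iff c_nonneg)
  then show ?thesis using s_sums by (simp add: sums_iff)
qed

text \<open>\<open>deriv\<close> is informative only once differentiability is known. Here
  \<open>q\<close> lies inside the unit interval, where the generating function is a power series
  and can be differentiated termwise.\<close>

lemma d_sums: "(\<lambda>m. real (Suc m) * c m * q ^ m) sums d"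
proof -
  \<comment> \<open>\<open>C m\<close> is the probability that exactly \<open>m\<close> draws are
    needed; the leading zero aligns coefficients with exponents.\<close>
  define C where "C m = (case m of 0 \<Rightarrow> 0 | Suc k \<Rightarrow> c k)" for m
  have C: "(\<lambda>m. C m * z ^ m) sums cc_pgf n P z" if "\<bar>z\<bar> < 1" for z
    using cc_pgf_real_sums[of z] that sums_Suc_iff[of "\<lambda>m. C m * z ^ m" "cc_pgf n P z"]
    by (simp add: C_def)
  have "((\<lambda>z. \<Sum>m. C m * z ^ m) has_field_derivative (\<Sum>m. diffs C m * q ^ m)) (at q)"
    using C rho by (intro termdiffs_strong'[of 1]) (auto simp: sums_iff)
  moreover have "\<forall>\<^sub>F z in nhds q. (\<Sum>m. C m * z ^ m) = cc_pgf n P z"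
  proof -
    have "\<forall>\<^sub>F z in nhds q. z \<in> {-1<..<1}"
      using rho by (intro eventually_nhds_in_open) auto
    then show ?thesis by eventually_elim (use C in \<open>auto simp: sums_iff\<close>)
  qed
  ultimately have "(cc_pgf n P has_field_derivative (\<Sum>m. diffs C m * q ^ m)) (at q)"
    by (subst (asm) DERIV_cong_ev[OF refl _ refl]) auto
  then have "d = (\<Sum>m. diffs C m * q ^ m)"
    unfolding d_def by (rule DERIV_imp_deriv)
  moreover have "summable (\<lambda>m. diffs C m * q ^ m)"
    using C rho by (intro termdiff_converges[of _ 1]) (auto simp: sums_iff)
  ultimately have "(\<lambda>m. diffs C m * q ^ m) sums d" by (simp add: sums_iff)
  then show ?thesis by (simp add: diffs_def C_def)
qed

text \<open>The ordinary collector's generating function at \<open>q * z\<close>;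
  \<open>cc_pgf\<close> takes only real arguments.\<close>

definition \<Phi> :: "complex \<Rightarrow> complex" where
  "\<Phi> z = (\<integral>\<omega>. (of_real q * z) ^ cc_time n \<omega> \<partial>stream_space (measure_pmf P))"

lemma norm_qz: "norm z \<le> 1 \<Longrightarrow> norm (of_real q * z :: complex) < 1"
proof -
  assume "norm z \<le> 1"
  then have "q * norm z \<le> q * 1" using rho by (intro mult_left_mono) auto
  then have "norm (of_real q * z) \<le> q" using rho by (simp add: norm_mult del: of_real_diff)
  also have "q < 1" using rho by simp
  finally show ?thesis .
qed

lemma \<Phi>_sums: "norm z \<le> 1 \<Longrightarrow> (\<lambda>m. of_real (c m) * (of_real q * z) ^ Suc m) sums \<Phi> z"
  unfolding \<Phi>_def using norm_qz[of z] by (intro cc_pgf_sums) auto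

text \<open>Termwise, \<open>norm (z ^ Suc m - 1) \<le> Suc m * norm (1 - z)\<close> on the closed
  disc, and the resulting weights sum to \<open>q * d\<close>.\<close>

lemma \<Phi>_diff_bound:
  assumes z: "norm z \<le> 1"
  shows "norm (\<Phi> z - of_real s) \<le> norm (1 - z) * (q * d)"
proof -
  have "(\<lambda>m. of_real (c m * q ^ Suc m) :: complex) sums of_real s"
    using s_sums by (subst sums_of_real_iff)
  with \<Phi>_sums[OF z] have *: "(\<lambda>m. of_real (c m) * (of_real q * z) ^ Suc m - of_real (c m * q ^ Suc m)) sums (\<Phi> z - of_real s)"
    by (rule sums_diff)
  have d': "(\<lambda>m. norm (1 - z) * (q * (real (Suc m) * c m * q ^ m))) sums (norm (1 - z) * (q * d))"
    by (intro sums_mult d_sums)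
  have "norm (\<Sum>m. of_real (c m) * (of_real q * z) ^ Suc m - of_real (c m * q ^ Suc m)) \<le>
      (\<Sum>m. norm (1 - z) * (q * (real (Suc m) * c m * q ^ m)))"
  proof (rule norm_suminf_le)
    fix m
    have "norm (z ^ Suc m - 1 ^ Suc m) \<le> real (Suc m) * norm (z - 1)"
      using z by (intro norm_power_diff) auto
    then have bd: "norm (z ^ Suc m - 1) \<le> real (Suc m) * norm (1 - z)"
      by (simp add: norm_minus_commute)
    have "of_real (c m) * (of_real q * z) ^ Suc m - of_real (c m * q ^ Suc m) =
        of_real (c m * q ^ Suc m) * (z ^ Suc m - 1)"
      unfolding power_mult_distrib of_real_mult of_real_power by (simp only: right_diff_distrib mult.assoc mult_1_right)
    then have "norm (of_real (c m) * (of_real q * z) ^ Suc m - of_real (c m * q ^ Suc m)) =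
        c m * q ^ Suc m * norm (z ^ Suc m - 1)"
      using c_nonneg[of m] rho by (simp only: norm_mult norm_of_real) (simp add: abs_mult)
    also have "\<dots> \<le> c m * q ^ Suc m * (real (Suc m) * norm (1 - z))"
      using c_nonneg[of m] rho by (intro mult_left_mono bd) auto
    also have "\<dots> = norm (1 - z) * (q * (real (Suc m) * c m * q ^ m))"
      by (simp only: power_Suc mult_ac)
    finally show "norm (of_real (c m) * (of_real q * z) ^ Suc m - of_real (c m * q ^ Suc m)) \<le>
        norm (1 - z) * (q * (real (Suc m) * c m * q ^ m))" .
  qed (use d' in \<open>simp add: sums_iff\<close>)
  with * d' show ?thesis by (simp only: sums_iff)
qed

section \<open>The renewal equation of the reset collector\<close>

lemma b_nonneg: "0 \<le> b t"
  using rho by (simp add: b_def survival_bounds)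

lemma summable_b: "summable b"
proof (rule summable_comparison_test')
  show "summable (\<lambda>t. q ^ t)" using rho by (intro summable_geometric) auto
  show "norm (b t) \<le> q ^ t" for t
    using rho by (auto simp: b_def abs_mult survival_bounds intro!: mult_left_le)
qed

lemma renewal: "h {} t = b t + \<rho> * (\<Sum>k<t. b k * h {} (t - Suc k))"
  unfolding b_def by (rule renewal_from) simp

text \<open>This is the tail series of the ordinary collector at \<open>q\<close>, where the factor
  \<open>1 - z\<close> of \<open>increments_gf\<close> equals \<open>\<rho>\<close>.\<close>

lemma rho_suminf_b: "\<rho> * suminf b = 1 - s"
proof -
  have "(\<lambda>t. of_real (g {} t) * q ^ t) sums suminf b"
    using summable_sums[OF summable_b] by (simp add: b_def[abs_def] mult.commute)
  from increments_gf[of "g {}", OF g_0 this] have "(\<lambda>m. c m * q ^ Suc m) sums (1 - (1 - q) * suminf b)"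
    by (simp add: c_def)
  from sums_unique2[OF this s_sums] show ?thesis by simp
qed

lemma summable_h: "summable (h {})"
  using rho s_pos
  by (intro renewal_summable[OF renewal _ b_nonneg _ summable_b])
     (auto simp: rho_suminf_b survival_bounds)

lemma h_tendsto_0: "h {} \<longlonglongrightarrow> 0"
  by (rule summable_LIMSEQ_zero[OF summable_h])

lemma h_gf:
  fixes z :: "'b::{real_normed_field,banach}"
  assumes "norm z \<le> 1"
  shows "(\<Sum>t. of_real (h {} t) * z ^ t) = (\<Sum>t. of_real (b t) * z ^ t) +
      of_real \<rho> * z * (\<Sum>t. of_real (b t) * z ^ t) * (\<Sum>t. of_real (h {} t) * z ^ t)"
  by (rule renewal_gf[OF renewal _ b_nonneg summable_b summable_h assms]) (rule survival_bounds)

text \<open>The generating function identity at \<open>z = 1\<close>. Tails sum to the mean, so the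
  mean of \<open>reset_time\<close> is \<open>(1 - s) / (\<rho> * s)\<close>.\<close>

lemma suminf_h: "\<rho> * s * suminf (h {}) = 1 - s"
proof -
  have "suminf (h {}) = suminf b + \<rho> * suminf b * suminf (h {})"
    using h_gf[of "1::real"] by simp
  then have "suminf (h {}) * s = suminf b"
    by (simp add: rho_suminf_b algebra_simps)
  then show ?thesis
    using rho_suminf_b by (simp add: mult.assoc mult.commute[of s])
qed

lemma prob_reset_time_gt:
  "measure (stream_space (measure_pmf D)) {\<omega>. t < reset_time n \<omega>} = h {} t"
  unfolding reset_time_eq by (rule prob_hitting_time_gt[OF h_tendsto_0])

text \<open>In product form no denominator has to be shown nonzero here; this is done in the limit,
  after division by \<open>\<rho> * s\<close>.\<close>

lemma reset_time_pgf:
  fixes z :: complex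
  assumes z: "norm z \<le> 1"
  shows "(\<integral>\<omega>. z ^ reset_time n \<omega> \<partial>stream_space (measure_pmf D)) * (1 - z + of_real \<rho> * z * \<Phi> z)
      = (1 - of_real q * z) * \<Phi> z"
proof -
  define U B where "U = (\<Sum>t. of_real (h {} t) * z ^ t)" and "B = (\<Sum>t. of_real (b t) * z ^ t)"
  have U: "U = B + of_real \<rho> * z * B * U"
    unfolding U_def B_def by (rule h_gf[OF z])
  have "(\<lambda>t. of_real (h {} t) * z ^ t) sums U"
    unfolding U_def
    by (rule summable_sums[OF summable_norm_cancel[OF summable_norm_weighted[OF summable_h survival_bounds(1) z]]])
  from increments_gf[of "h {}", OF h_0 this]
  have "(\<lambda>m. of_real (h {} m - h {} (Suc m)) * z ^ Suc m) sums (1 - (1 - z) * U)" .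
  from sums_unique2[OF hitting_time_pgf_sums[OF h_tendsto_0 start_incomplete(1) z] this]
  have \<psi>: "(\<integral>\<omega>. z ^ reset_time n \<omega> \<partial>stream_space (measure_pmf D)) = 1 - (1 - z) * U"
    by (simp add: reset_time_eq)
  have "(\<lambda>t. of_real (b t) * z ^ t) sums B"
    unfolding B_def
    by (rule summable_sums[OF summable_norm_cancel[OF summable_norm_weighted[OF summable_b b_nonneg z]]])
  then have "(\<lambda>t. of_real (g {} t) * (of_real q * z) ^ t) sums B"
    by (simp only: b_def power_mult_distrib of_real_mult of_real_power mult_ac)
  from increments_gf[of "g {}", OF g_0 this]
  have "(\<lambda>m. of_real (c m) * (of_real q * z) ^ Suc m) sums (1 - (1 - of_real q * z) * B)"
    by (simp only: c_def)
  from sums_unique2[OF \<Phi>_sums[OF z] this] have \<Phi>: "\<Phi> z = 1 - (1 - of_real q * z) * B" .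
  \<comment> \<open>The algebra rests on \<open>1 - z + K = w\<close>, that is
    \<open>\<rho> + q = 1\<close>. Multiplying the generating function by \<open>1 - K * B\<close>
    gives \<open>\<Phi> z\<close>, while the denominator equals
    \<open>w * (1 - K * B)\<close>.\<close>
  define w K where "w = 1 - of_real q * z" and "K = of_real \<rho> * z"
  have w: "1 - z + K = w" by (simp add: w_def K_def algebra_simps)
  have UK: "U - K * B * U = B"
    unfolding diff_eq_eq K_def by (rule U)
  have "(1 - (1 - z) * U) * (1 - K * B) = 1 - K * B - (1 - z) * (U - K * B * U)"
    by (simp add: algebra_simps)
  also have "\<dots> = 1 - (1 - z + K) * B"
    unfolding UK by (simp add: algebra_simps)
  finally have *: "(1 - (1 - z) * U) * (1 - K * B) = 1 - w * B" unfolding w .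
  have "1 - z + K * (1 - w * B) = (1 - z + K) - w * (K * B)"
    by (simp add: algebra_simps)
  then have "1 - z + K * (1 - w * B) = w * (1 - K * B)"
    unfolding w by (simp add: right_diff_distrib)
  then have "(1 - (1 - z) * U) * (1 - z + K * (1 - w * B)) = w * ((1 - (1 - z) * U) * (1 - K * B))"
    by (simp only: mult.left_commute)
  then show ?thesis unfolding * unfolding \<psi> \<Phi> w_def K_def .
qed

text \<open>The constants are the same for all parameters, as dominated convergence along the
  sequence requires.\<close>

lemma tail_bound:
  assumes "0 \<le> x"
  shows "measure (stream_space (measure_pmf D)) {\<omega>. x < \<rho> * s * real (reset_time n \<omega>)} \<le> 2 * exp (- (ln 2 / 2) * x)"
proof -
  interpret S: prob_space "stream_space (measure_pmf D)" by (rule prob_space_stream_space_pmf)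
  \<comment> \<open>Twice the bound on the mean, so that Markov's inequality leaves survival
    probability at most 1/2 over a block of \<open>t\<close> draws. After scaling by
    \<open>\<rho> * s\<close> a block has length at most 2, so \<open>j\<close> blocks fit below
    \<open>x\<close>.\<close>
  define t where "t = nat \<lfloor>2 / (\<rho> * s)\<rfloor>"
  define j where "j = nat \<lfloor>x / 2\<rfloor>"
  have rs: "0 < \<rho> * s" using rho s_pos by simp
  have t: "real t \<le> 2 / (\<rho> * s)" "2 / (\<rho> * s) < real t + 1"
    using rs by (auto simp: t_def)
  have j: "real j \<le> x / 2" "x / 2 < real j + 1"
    using assms by (auto simp: j_def) linarith
  have anti: "h {} t \<le> h {} i" if "i \<le> t" for i
    using that by (rule lift_Suc_antimono_le[of "h {}", OF survival_antimono])
  \<comment> \<open>Markov's inequality in discrete form: the tails decrease, so each of the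
    \<open>t + 1\<close> tails up to \<open>t\<close> is at least \<open>h {} t\<close>.\<close>
  have "(real t + 1) * h {} t = (\<Sum>i\<le>t. h {} t)" by simp
  also have "\<dots> \<le> (\<Sum>i\<le>t. h {} i)" by (intro sum_mono anti) auto
  also have "\<dots> \<le> suminf (h {})"
    by (intro sum_le_suminf summable_h) (auto simp: survival_bounds)
  also have "\<dots> = (1 - s) / (\<rho> * s)"
    using suminf_h rs by (metis less_irrefl nonzero_mult_div_cancel_left)
  also have "\<dots> \<le> (1 / 2) * (2 / (\<rho> * s))"
    using rs s_pos by (simp add: divide_right_mono)
  also have "\<dots> \<le> (1 / 2) * (real t + 1)"
    using t by (intro mult_left_mono) auto
  finally have half: "h {} t \<le> 1 / 2"
    by (simp add: mult.commute)
  have "S.prob {\<omega>. x < \<rho> * s * real (reset_time n \<omega>)} \<le> S.prob {\<omega>. j * t < reset_time n \<omega>}"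
  proof (rule S.finite_measure_mono)
    show "{\<omega>. x < \<rho> * s * real (reset_time n \<omega>)} \<subseteq> {\<omega>. j * t < reset_time n \<omega>}"
    proof safe
      fix \<omega> assume x: "x < \<rho> * s * real (reset_time n \<omega>)"
      have "real (j * t) \<le> (x / 2) * (2 / (\<rho> * s))"
        unfolding of_nat_mult using j t assms by (intro mult_mono) auto
      also have "\<dots> = x / (\<rho> * s)" by simp
      also have "\<dots> < real (reset_time n \<omega>)"
        using x rs by (simp add: field_simps)
      finally show "j * t < reset_time n \<omega>" by (simp only: of_nat_less_iff)
    qed
  qed (simp add: reset_time_eq)
  also have "\<dots> \<le> h {} t ^ j" by (simp only: prob_reset_time_gt h_mult)
  also have "\<dots> \<le> (1 / 2) ^ j" by (intro power_mono half survival_bounds)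
  also have "\<dots> = exp (- ln 2 * real j)"
    by (simp add: exp_minus exp_of_nat_mult mult.commute[of "ln 2"] power_one_over inverse_eq_divide)
  \<comment> \<open>Rounding down gives only \<open>j > x / 2 - 1\<close>, which costs the factor
    2.\<close>
  also have "\<dots> \<le> exp (ln 2 + - (ln 2 / 2) * x)"
  proof -
    have "ln 2 * (x / 2 - 1) \<le> ln 2 * real j"
      using j(2) by (intro mult_left_mono) auto
    then show ?thesis by (simp add: algebra_simps)
  qed
  also have "\<dots> = 2 * exp (- (ln 2 / 2) * x)"
    by (simp only: exp_add) simp
  finally show ?thesis .
qed

end

section \<open>The exponential law and convergence of moments\<close>

text \<open>On \<open>{0..k}\<close> the antiderivative \<open>exp (x * w) / w\<close> with
  \<open>w = \<i> * t - 1\<close> applies; letting \<open>k\<close> grow is dominated by the density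
  itself.\<close>

lemma char_exponential:
  "char (density lborel (exponential_density 1)) t = 1 / (1 - \<i> * of_real t)"
proof -
  define w where "w = \<i> * of_real t - 1"
  have w: "w \<noteq> 0" by (auto simp: w_def complex_eq_iff)
  define f where "f x = exp (of_real x * w)" for x :: real
  have nf: "norm (f x) = exp (- x)" for x
    by (simp add: f_def w_def norm_exp_eq_Re)
  have cf: "continuous_on A f" for A
    unfolding f_def by (intro continuous_intros)
  have [measurable]: "f \<in> borel_measurable borel"
    by (intro borel_measurable_continuous_onI cf)
  have fin: "integral\<^sup>L lborel (\<lambda>x. indicator {0..real k} x *\<^sub>R f x) = f (real k) / w - f 0 / w" for k
  proof (rule integral_FTC_atLeastAtMost)
    fix x
    have "((\<lambda>y. exp (y * w) / w) has_field_derivative exp (of_real x * w)) (at (of_real x))"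
      using w by (auto intro!: derivative_eq_intros)
    then show "((\<lambda>x. f x / w) has_vector_derivative f x) (at x within {0..real k})"
      unfolding f_def by (intro has_vector_derivative_real_field)
  qed (use cf in auto)
  have lim1: "(\<lambda>k. integral\<^sup>L lborel (\<lambda>x. indicator {0..real k} x *\<^sub>R f x)) \<longlonglongrightarrow>
      integral\<^sup>L lborel (\<lambda>x. exponential_density 1 x *\<^sub>R iexp (t * x))"
  proof (rule integral_dominated_convergence[where w="exponential_density 1"])
    show "integrable lborel (exponential_density 1)"
      using nn_integral_erlang_ith_moment[of 1 0 0]
      by (intro integrableI_nonneg) (auto simp: exponential_density_nonneg)
    show "AE x in lborel. (\<lambda>k. indicat_real {0..real k} x *\<^sub>R f x) \<longlonglongrightarrow> exponential_density 1 x *\<^sub>R iexp (t * x)"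
    proof (rule AE_I2)
      fix x :: real
      obtain K :: nat where K: "x \<le> real K" using real_arch_simple by blast
      have "\<forall>\<^sub>F k in sequentially. indicat_real {0..real k} x *\<^sub>R f x = exponential_density 1 x *\<^sub>R iexp (t * x)"
        using eventually_ge_at_top[of K]
      proof eventually_elim
        case (elim k)
        have "f x = of_real (exp (- x)) * iexp (t * x)"
          by (simp add: f_def w_def exp_of_real[symmetric] exp_add[symmetric] algebra_simps)
        with K elim show ?case
          by (auto simp: exponential_density_def scaleR_conv_of_real split: split_indicator)
      qed
      then show "(\<lambda>k. indicat_real {0..real k} x *\<^sub>R f x) \<longlonglongrightarrow> exponential_density 1 x *\<^sub>R iexp (t * x)"
        by (rule tendsto_eventually)
    qed
    show "AE x in lborel. norm (indicat_real {0..real k} x *\<^sub>R f x) \<le> exponential_density 1 x" for k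
      by (auto simp: nf exponential_density_def split: split_indicator)
  qed measurable
  have "((\<lambda>k. f (real k)) \<longlonglongrightarrow> 0)"
  proof (rule tendsto_norm_zero_cancel)
    show "(\<lambda>k. norm (f (real k))) \<longlonglongrightarrow> 0"
      unfolding nf
      by (rule filterlim_compose[OF exp_at_bot])
         (intro filterlim_compose[OF filterlim_uminus_at_bot_at_top] filterlim_real_sequentially)
  qed
  then have "(\<lambda>k. f (real k) / w - f 0 / w) \<longlonglongrightarrow> 0 / w - f 0 / w"
    using w by (intro tendsto_intros) auto
  then have "integral\<^sup>L lborel (\<lambda>x. exponential_density 1 x *\<^sub>R iexp (t * x)) = 0 / w - f 0 / w"
    using lim1 unfolding fin by (intro LIMSEQ_unique)
  also have "\<dots> = 1 / (1 - \<i> * of_real t)"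
  proof -
    have "1 - \<i> * of_real t = - w" by (simp add: w_def)
    then show ?thesis by (simp add: f_def)
  qed
  finally show ?thesis
    unfolding char_def by (subst integral_density) (auto simp: exponential_density_nonneg)
qed

lemma real_distribution_exponential: "real_distribution (density lborel (exponential_density 1))"
  by (auto simp: real_distribution_def real_distribution_axioms_def intro!: prob_space_exponential_density)

lemma cdf_exponential: "0 \<le> x \<Longrightarrow> cdf (density lborel (exponential_density 1)) x = 1 - exp (- x)"
proof -
  assume "0 \<le> x"
  have "emeasure (density lborel (exponential_density 1)) {..x} = ennreal (erlang_CDF 0 1 x)"
    by (subst emeasure_density) (simp_all add: nn_integral_erlang_density)
  with \<open>0 \<le> x\<close> show ?thesis by (simp add: cdf_def measure_def erlang_CDF_0)
qed

text \<open>A law with a density has no atoms. Weak convergence therefore gives convergence of the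
  tails at every fixed point.\<close>

lemma isCont_cdf_exponential: "isCont (cdf (density lborel (exponential_density 1))) x"
proof -
  interpret real_distribution "density lborel (exponential_density 1)"
    by (rule real_distribution_exponential)
  have "AE y in lborel. y \<noteq> x" by (rule AE_lborel_singleton)
  then have "emeasure (density lborel (exponential_density 1)) {x} = 0"
    by (subst emeasure_density, simp, simp, subst nn_integral_0_iff_AE) (auto simp: indicator_def)
  then show ?thesis by (simp add: isCont_cdf measure_def)
qed

section \<open>Layer-cake formula and convergence of moments\<close>

lemma (in prob_space) nn_moment_layer_cake:
  fixes X :: "'a \<Rightarrow> real"
  assumes [measurable]: "X \<in> borel_measurable M" and nonneg: "\<And>\<omega>. \<omega> \<in> space M \<Longrightarrow> 0 \<le> X \<omega>"
  shows "(\<integral>\<^sup>+\<omega>. ennreal (X \<omega> ^ Suc k) \<partial>M) =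
    (\<integral>\<^sup>+t. ennreal (indicator {0..} t * (real (Suc k) * t ^ k * prob {\<omega>\<in>space M. t < X \<omega>})) \<partial>lborel)"
proof -
  interpret pair_sigma_finite M lborel ..
  have "(\<integral>\<^sup>+\<omega>. ennreal (X \<omega> ^ Suc k) \<partial>M) =
      (\<integral>\<^sup>+\<omega>. (\<integral>\<^sup>+t. ennreal (indicator {0..} t * (real (Suc k) * t ^ k)) * indicator {\<omega>. t < X \<omega>} \<omega> \<partial>lborel) \<partial>M)"
  proof (rule nn_integral_cong)
    fix \<omega> assume \<omega>: "\<omega> \<in> space M"
    have "(\<integral>\<^sup>+t. ennreal (real (Suc k) * t ^ k) * indicator {0..X \<omega>} t \<partial>lborel) = ennreal (X \<omega> ^ Suc k - 0 ^ Suc k)"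
      using nonneg[OF \<omega>]
      by (intro nn_integral_FTC_Icc) (auto intro!: derivative_eq_intros simp del: power_Suc)
    \<comment> \<open>The integrands differ at most at the point \<open>t = X \<omega>\<close>, a
      null set.\<close>
    moreover have "(\<integral>\<^sup>+t. ennreal (indicator {0..} t * (real (Suc k) * t ^ k)) * indicator {\<omega>. t < X \<omega>} \<omega> \<partial>lborel) =
        (\<integral>\<^sup>+t. ennreal (real (Suc k) * t ^ k) * indicator {0..X \<omega>} t \<partial>lborel)"
      by (rule nn_integral_cong_AE, rule eventually_mono[OF AE_lborel_singleton[of "X \<omega>"]])
         (auto split: split_indicator)
    ultimately show "ennreal (X \<omega> ^ Suc k) =
        (\<integral>\<^sup>+t. ennreal (indicator {0..} t * (real (Suc k) * t ^ k)) * indicator {\<omega>. t < X \<omega>} \<omega> \<partial>lborel)"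
      by simp
  qed
  also have "\<dots> = (\<integral>\<^sup>+t. (\<integral>\<^sup>+\<omega>. ennreal (indicator {0..} t * (real (Suc k) * t ^ k)) * indicator {\<omega>. t < X \<omega>} \<omega> \<partial>M) \<partial>lborel)"
    by (rule Fubini'[symmetric]) (simp add: indicator_def)
  also have "\<dots> = (\<integral>\<^sup>+t. ennreal (indicator {0..} t * (real (Suc k) * t ^ k * prob {\<omega>\<in>space M. t < X \<omega>})) \<partial>lborel)"
  proof (rule nn_integral_cong)
    fix t :: real
    have "(\<integral>\<^sup>+\<omega>. ennreal (indicator {0..} t * (real (Suc k) * t ^ k)) * indicator {\<omega>. t < X \<omega>} \<omega> \<partial>M) =
        (\<integral>\<^sup>+\<omega>. ennreal (indicator {0..} t * (real (Suc k) * t ^ k)) * indicator {\<omega>\<in>space M. t < X \<omega>} \<omega> \<partial>M)"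
      by (rule nn_integral_cong) (auto split: split_indicator)
    also have "\<dots> = ennreal (indicator {0..} t * (real (Suc k) * t ^ k)) * emeasure M {\<omega>\<in>space M. t < X \<omega>}"
      by (subst nn_integral_cmult_indicator) auto
    also have "\<dots> = ennreal (indicator {0..} t * (real (Suc k) * t ^ k) * prob {\<omega>\<in>space M. t < X \<omega>})"
      by (simp add: emeasure_eq_measure ennreal_mult'' split: split_indicator)
    finally show "(\<integral>\<^sup>+\<omega>. ennreal (indicator {0..} t * (real (Suc k) * t ^ k)) * indicator {\<omega>. t < X \<omega>} \<omega> \<partial>M) =
        ennreal (indicator {0..} t * (real (Suc k) * t ^ k * prob {\<omega>\<in>space M. t < X \<omega>}))"
      by (simp add: mult.assoc)
  qed
  finally show ?thesis .
qed

lemma (in prob_space) tail_measurable: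
  fixes X :: "'a \<Rightarrow> real"
  assumes [measurable]: "X \<in> borel_measurable M"
  shows "(\<lambda>t. prob {\<omega>\<in>space M. t < X \<omega>}) \<in> borel_measurable borel"
proof -
  have "mono (\<lambda>t. - prob {\<omega>\<in>space M. t < X \<omega>})"
    by (intro monoI) (auto intro!: finite_measure_mono)
  then have "(\<lambda>t. - prob {\<omega>\<in>space M. t < X \<omega>}) \<in> borel_measurable borel"
    by (rule borel_measurable_mono)
  then show ?thesis by simp
qed

text \<open>Both sides are \<open>enn2real\<close> of the same nonnegative integral, so they agree
  even when it is infinite: both are then 0.\<close>

lemma (in prob_space) moment_layer_cake:
  fixes X :: "'a \<Rightarrow> real"
  assumes [measurable]: "X \<in> borel_measurable M" and nonneg: "\<And>\<omega>. \<omega> \<in> space M \<Longrightarrow> 0 \<le> X \<omega>"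
  shows "(\<integral>\<omega>. X \<omega> ^ Suc k \<partial>M) =
    (\<integral>t. indicator {0..} t * (real (Suc k) * t ^ k * prob {\<omega>\<in>space M. t < X \<omega>}) \<partial>lborel)"
proof -
  note tail_measurable[of X, measurable]
  have "(\<integral>\<omega>. X \<omega> ^ Suc k \<partial>M) = enn2real (\<integral>\<^sup>+\<omega>. ennreal (X \<omega> ^ Suc k) \<partial>M)"
    using nonneg by (intro integral_eq_nn_integral AE_I2) auto
  also have "\<dots> = (\<integral>t. indicator {0..} t * (real (Suc k) * t ^ k * prob {\<omega>\<in>space M. t < X \<omega>}) \<partial>lborel)"
    by (subst nn_moment_layer_cake[OF assms], assumption)
       (intro integral_eq_nn_integral[symmetric] AE_I2, auto split: split_indicator)
  finally show ?thesis .
qed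

lemma moments_tendsto_fact:
  fixes X :: "nat \<Rightarrow> 'a \<Rightarrow> real" and M :: "nat \<Rightarrow> 'a measure"
  assumes M: "\<And>n. prob_space (M n)" and X: "\<And>n. X n \<in> borel_measurable (M n)"
    and nonneg: "\<And>n \<omega>. N \<le> n \<Longrightarrow> 0 \<le> X n \<omega>"
    and lim: "\<And>t. 0 \<le> t \<Longrightarrow> (\<lambda>n. measure (M n) {\<omega>\<in>space (M n). t < X n \<omega>}) \<longlonglongrightarrow> exp (- t)"
    and tail: "\<And>n t. N \<le> n \<Longrightarrow> 0 \<le> t \<Longrightarrow> measure (M n) {\<omega>\<in>space (M n). t < X n \<omega>} \<le> C * exp (- a * t)"
    and a: "0 < a"
  shows "(\<lambda>n. \<integral>\<omega>. X n \<omega> ^ Suc k \<partial>M n) \<longlonglongrightarrow> fact (Suc k)"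
proof -
  define f where "f n t = indicator {0..} t * (real (Suc k) * t ^ k * measure (M n) {\<omega>\<in>space (M n). t < X n \<omega>})" for n and t :: real
  define l where "l t = indicator {0..} t * (real (Suc k) * t ^ k * exp (- t))" for t :: real
  \<comment> \<open>The prefactor cancels the normalisation of the Erlang density:
    \<open>w t = C * Suc k * t ^ k * exp (- a * t)\<close> for \<open>t \<ge> 0\<close>, exactly the
    bound coming from \<open>tail\<close>.\<close>
  define w where "w t = (C * fact (Suc k) / a ^ Suc k) * erlang_density k a t" for t
  have "(\<integral>\<^sup>+t. ennreal (l t) \<partial>lborel) = (\<integral>\<^sup>+t. ennreal (real (Suc k)) * (ennreal (t ^ k * exp (- t)) * indicator {0..} t) \<partial>lborel)"
    by (intro nn_integral_cong) (auto simp: l_def ennreal_mult' mult.assoc split: split_indicator)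
  also have "\<dots> = ennreal (real (Suc k)) * ennreal (fact k)"
    by (subst nn_integral_cmult) (simp_all add: nn_intergal_power_times_exp_Ici)
  also have "\<dots> = ennreal (fact (Suc k))"
    by (subst ennreal_mult''[symmetric]) (simp_all add: algebra_simps)
  finally have "(\<integral>t. l t \<partial>lborel) = fact (Suc k)"
    by (intro integral_eq_nn_integral[THEN trans]) (auto simp: l_def split: split_indicator)
  \<comment> \<open>Nonnegativity and the tail bound start at index \<open>N\<close>, hence the
    shift, undone at the end by \<open>LIMSEQ_offset\<close>.\<close>
  moreover have "(\<lambda>n. \<integral>t. f (n + N) t \<partial>lborel) \<longlonglongrightarrow> (\<integral>t. l t \<partial>lborel)"
  proof (rule integral_dominated_convergence[where w=w])
    show "l \<in> borel_measurable lborel" unfolding l_def by measurable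
    show "f (n + N) \<in> borel_measurable lborel" for n
      using prob_space.tail_measurable[OF M X, of "n + N"] unfolding f_def by measurable
    show "integrable lborel w"
      unfolding w_def using nn_integral_erlang_ith_moment[OF a, of k 0] a
      by (intro integrable_mult_right integrableI_nonneg) auto
    show "AE t in lborel. (\<lambda>n. f (n + N) t) \<longlonglongrightarrow> l t"
      using lim[THEN LIMSEQ_ignore_initial_segment, of _ N]
      by (intro AE_I2) (auto simp: f_def l_def split: split_indicator intro!: tendsto_intros)
    show "AE t in lborel. norm (f (n + N) t) \<le> w t" for n
    proof (rule AE_I2)
      fix t :: real
      show "norm (f (n + N) t) \<le> w t"
      proof (cases "0 \<le> t")
        case True
        then have "real (Suc k) * t ^ k * measure (M (n + N)) {\<omega>\<in>space (M (n + N)). t < X (n + N) \<omega>} \<le>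
            real (Suc k) * t ^ k * (C * exp (- a * t))"
          by (intro mult_left_mono tail) auto
        with True a show ?thesis
          by (simp add: f_def w_def erlang_density_def abs_mult mult_ac del: of_nat_Suc)
      qed (simp add: f_def w_def erlang_density_def)
    qed
  qed
  ultimately have "(\<lambda>n. \<integral>t. f (n + N) t \<partial>lborel) \<longlonglongrightarrow> fact (Suc k)" by simp
  moreover have "(\<integral>\<omega>. X (n + N) \<omega> ^ Suc k \<partial>M (n + N)) = (\<integral>t. f (n + N) t \<partial>lborel)" for n
    unfolding f_def by (intro prob_space.moment_layer_cake M X nonneg) auto
  ultimately have "(\<lambda>n. \<integral>\<omega>. X (n + N) \<omega> ^ Suc k \<partial>M (n + N)) \<longlonglongrightarrow> fact (Suc k)" by simp
  then show ?thesis by (rule LIMSEQ_offset)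
qed

section \<open>The limit\<close>

text \<open>The analytic core, free of probability: \<open>\<psi> n\<close> stands for the
  characteristic function of the scaled time at \<open>t\<close>, and \<open>\<Phi> n\<close> for
  the ordinary collector's generating function at \<open>q * z\<close>.\<close>

lemma char_limit_of_pgf_identity:
  fixes \<rho> s d :: "nat \<Rightarrow> real" and \<Phi> \<psi> :: "nat \<Rightarrow> complex" and t :: real
  defines "z \<equiv> \<lambda>n. iexp (t * (\<rho> n * s n))"
  assumes rho: "\<And>n. n \<ge> 1 \<Longrightarrow> 0 < \<rho> n \<and> \<rho> n < 1" and s_pos: "\<And>n. n \<ge> 1 \<Longrightarrow> 0 < s n"
    and s: "s \<longlonglongrightarrow> 0" and d: "(\<lambda>n. \<rho> n * (1 - \<rho> n) * d n) \<longlonglongrightarrow> 0"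
    and \<Phi>: "\<And>n. n \<ge> 1 \<Longrightarrow> norm (\<Phi> n - of_real (s n)) \<le> norm (1 - z n) * ((1 - \<rho> n) * d n)"
    and \<psi>: "\<And>n. n \<ge> 1 \<Longrightarrow> \<psi> n * (1 - z n + of_real (\<rho> n) * z n * \<Phi> n) = (1 - of_real (1 - \<rho> n) * z n) * \<Phi> n"
  shows "\<psi> \<longlonglongrightarrow> 1 / (1 - \<i> * of_real t)"
proof -
  define e where "e n = \<rho> n * s n" for n
  have e_pos: "0 < e n" if "n \<ge> 1" for n using rho[OF that] s_pos[OF that] by (simp add: e_def)
  have ge1: "\<forall>\<^sub>F n in sequentially. n \<ge> (1::nat)" by (rule eventually_ge_at_top)
  have e: "e \<longlonglongrightarrow> 0"
  proof (rule tendsto_sandwich[OF _ _ tendsto_const s])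
    show "\<forall>\<^sub>F n in sequentially. 0 \<le> e n" using ge1 by eventually_elim (simp add: e_pos less_imp_le)
    show "\<forall>\<^sub>F n in sequentially. e n \<le> s n"
      using ge1 by eventually_elim (use rho s_pos in \<open>auto simp: e_def intro!: mult_left_le_one_le less_imp_le\<close>)
  qed
  have qs: "(\<lambda>n. (1 - \<rho> n) * s n) \<longlonglongrightarrow> 0"
    using tendsto_diff[OF s e] by (simp add: e_def[abs_def] algebra_simps)
  have "((\<lambda>x::complex. exp (\<i> * of_real t * x)) has_field_derivative \<i> * of_real t) (at 0)"
    by (auto intro!: derivative_eq_intros)
  then have DE: "((\<lambda>x::complex. (exp (\<i> * of_real t * x) - 1) / x) \<longlongrightarrow> \<i> * of_real t) (at 0)"
    by (simp add: DERIV_def)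
  have "filterlim (\<lambda>n. of_real (e n) :: complex) (at 0) sequentially"
  proof (rule filterlim_atI)
    show "(\<lambda>n. complex_of_real (e n)) \<longlonglongrightarrow> 0" using tendsto_of_real[OF e] by simp
    show "\<forall>\<^sub>F n in sequentially. complex_of_real (e n) \<noteq> 0"
      using ge1 by eventually_elim (use e_pos in force)
  qed
  from filterlim_compose[OF DE this]
  have "(\<lambda>n. (z n - 1) / of_real (e n)) \<longlonglongrightarrow> \<i> * of_real t"
    by (simp add: z_def e_def mult.assoc)
  from tendsto_minus[OF this]
  have z': "(\<lambda>n. (1 - z n) / of_real (e n)) \<longlonglongrightarrow> - (\<i> * of_real t)"
    by (simp add: minus_divide_left)
  have "(\<lambda>n. iexp (t * e n)) \<longlonglongrightarrow> iexp (t * 0)"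
    by (intro tendsto_intros e)
  then have z1: "z \<longlonglongrightarrow> 1" by (simp add: z_def[abs_def] e_def)
  \<comment> \<open>Dividing the bound by \<open>s n = e n / \<rho> n\<close> splits it into the
    convergent quotient \<open>(1 - z n) / e n\<close> and the sequence assumed to vanish in
    \<open>d\<close>.\<close>
  have \<Phi>1: "(\<lambda>n. \<Phi> n / of_real (s n)) \<longlonglongrightarrow> 1"
  proof (rule Lim_null[THEN iffD2], rule Lim_null_comparison)
    show "(\<lambda>n. norm ((1 - z n) / of_real (e n)) * (\<rho> n * (1 - \<rho> n) * d n)) \<longlonglongrightarrow> 0"
      using tendsto_mult[OF tendsto_norm[OF z'] d] by simp
    show "\<forall>\<^sub>F n in sequentially. norm (\<Phi> n / of_real (s n) - 1) \<le>
        norm ((1 - z n) / of_real (e n)) * (\<rho> n * (1 - \<rho> n) * d n)"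
      using ge1
    proof eventually_elim
      case (elim n)
      note pos = s_pos[OF elim] rho[OF elim]
      have "\<Phi> n / of_real (s n) - 1 = (\<Phi> n - of_real (s n)) / of_real (s n)"
        using pos by (simp add: diff_divide_distrib)
      then have "norm (\<Phi> n / of_real (s n) - 1) = norm (\<Phi> n - of_real (s n)) / s n"
        using pos by (simp add: norm_divide)
      also have "\<dots> \<le> norm (1 - z n) * ((1 - \<rho> n) * d n) / s n"
        using pos by (intro divide_right_mono \<Phi> elim) auto
      also have "\<dots> = norm ((1 - z n) / of_real (e n)) * (\<rho> n * (1 - \<rho> n) * d n)"
        using pos by (simp add: norm_divide e_def norm_mult)
      finally show ?case .
    qed
  qed
  \<comment> \<open>\<open>N\<close> and \<open>K\<close> are the numerator and denominator divided
    by \<open>e n\<close>. Writing \<open>1 - q * z = \<rho> + q * (1 - z)\<close> produces the term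
    with \<open>(1 - \<rho> n) * s n\<close>, which vanishes in the limit.\<close>
  define N where "N n = (1 + of_real ((1 - \<rho> n) * s n) * ((1 - z n) / of_real (e n))) * (\<Phi> n / of_real (s n))" for n
  define K where "K n = (1 - z n) / of_real (e n) + z n * (\<Phi> n / of_real (s n))" for n
  have "N \<longlonglongrightarrow> (1 + of_real 0 * - (\<i> * of_real t)) * 1"
    unfolding N_def by (intro tendsto_intros qs z' \<Phi>1)
  moreover have K: "K \<longlonglongrightarrow> - (\<i> * of_real t) + 1 * 1"
    unfolding K_def by (intro tendsto_intros z' z1 \<Phi>1)
  moreover have nz: "- (\<i> * of_real t) + 1 * 1 \<noteq> (0::complex)"
    by (auto simp: complex_eq_iff)
  ultimately have "(\<lambda>n. N n / K n) \<longlonglongrightarrow> 1 / (1 - \<i> * of_real t)"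
    using tendsto_divide[of N _ sequentially K] by simp
  \<comment> \<open>\<open>K\<close> has a nonzero limit, so the product identity may be divided by
    it for all large \<open>n\<close>.\<close>
  moreover have "\<forall>\<^sub>F n in sequentially. N n / K n = \<psi> n"
    using ge1 tendsto_imp_eventually_ne[OF K nz]
  proof eventually_elim
    case (elim n)
    have nz: "\<rho> n \<noteq> 0" "s n \<noteq> 0" using s_pos[OF elim(1)] rho[OF elim(1)] by auto
    have "of_real (e n) * K n = 1 - z n + of_real (\<rho> n) * z n * \<Phi> n"
      using nz by (simp add: K_def e_def field_simps)
    moreover have "of_real (e n) * N n = (1 - of_real (1 - \<rho> n) * z n) * \<Phi> n"
      using nz by (simp add: N_def e_def field_simps)
    ultimately have "of_real (e n) * (\<psi> n * K n) = of_real (e n) * N n"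
      using \<psi>[OF elim(1)] by (metis mult.left_commute)
    then have "\<psi> n * K n = N n"
      using nz by (simp add: e_def)
    with elim(2) show ?case by (simp add: field_simps)
  qed
  ultimately show ?thesis by (rule Lim_transform_eventually)
qed

theorem mainTheorem2:
  fixes \<rho> :: "nat \<Rightarrow> real" and p :: "nat \<Rightarrow> nat \<Rightarrow> real"
    and D :: "nat \<Rightarrow> nat option pmf" and Pi :: "nat \<Rightarrow> nat pmf"
  assumes rho: "\<And>n. n \<ge> 1 \<Longrightarrow> 0 < \<rho> n \<and> \<rho> n < 1"
    and p_pos: "\<And>n i. n \<ge> 1 \<Longrightarrow> i < n \<Longrightarrow> p n i > 0"
    and p_sum: "\<And>n. n \<ge> 1 \<Longrightarrow> (\<Sum>i<n. p n i) = 1 - \<rho> n"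
    and D_reset: "\<And>n. n \<ge> 1 \<Longrightarrow> pmf (D n) None = \<rho> n"
    and D_std: "\<And>n i. n \<ge> 1 \<Longrightarrow> i < n \<Longrightarrow> pmf (D n) (Some i) = p n i"
    and Pi_def: "\<And>n i. n \<ge> 1 \<Longrightarrow> i < n \<Longrightarrow> pmf (Pi n) i = p n i / (1 - \<rho> n)"
    and s_lim: "(\<lambda>n. cc_pgf n (Pi n) (1 - \<rho> n)) \<longlonglongrightarrow> 0"
    and d_lim: "(\<lambda>n. \<rho> n * (1 - \<rho> n) * deriv (cc_pgf n (Pi n)) (1 - \<rho> n)) \<longlonglongrightarrow> 0"
  shows "weak_conv_m
           (\<lambda>n. distr (stream_space (measure_pmf (D n))) borel
                   (\<lambda>\<omega>. \<rho> n * cc_pgf n (Pi n) (1 - \<rho> n) * real (reset_time n \<omega>)))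
           (density lborel (exponential_density 1)) \<and>
         (\<forall>r::nat. r \<ge> 1 \<longrightarrow>
           (\<lambda>n. \<integral>\<omega>. (\<rho> n * cc_pgf n (Pi n) (1 - \<rho> n) * real (reset_time n \<omega>)) ^ r
                    \<partial>stream_space (measure_pmf (D n))) \<longlonglongrightarrow> fact r)"
proof -
  define M where "M n = stream_space (measure_pmf (D n))" for n
  define s where "s n = cc_pgf n (Pi n) (1 - \<rho> n)" for n
  define X where "X n \<omega> = \<rho> n * s n * real (reset_time n \<omega>)" for n \<omega>
  have rc: "reset_collector n (\<rho> n) (p n) (D n) (Pi n)" if "n \<ge> 1" for n
    using that rho p_pos p_sum D_reset D_std Pi_def by unfold_locales auto
  have s_eq: "s n = reset_collector.s n (\<rho> n) (Pi n)" if "n \<ge> 1" for n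
    by (simp add: s_def reset_collector.s_def[OF rc[OF that]])
  have s_pos: "0 < s n" if "n \<ge> 1" for n
    using reset_collector.s_pos[OF rc[OF that]] by (simp add: s_eq[OF that])
  \<comment> \<open>The parameters are unconstrained at \<open>n = 0\<close>, whereas Levy's theorem
    and the moment lemma ask for probability spaces and measurability at every index.\<close>
  have M: "prob_space (M n)" for n
    unfolding M_def by (rule prob_space_stream_space_pmf)
  have X: "X n \<in> borel_measurable (M n)" for n
    unfolding X_def[abs_def] M_def reset_time_eq by measurable
  have distr: "real_distribution (distr (M n) borel (X n))" for n
    using prob_space.real_distribution_distr[OF M X] .
  have weak: "weak_conv_m (\<lambda>n. distr (M n) borel (X n)) (density lborel (exponential_density 1))"
  proof (rule levy_continuity[OF distr real_distribution_exponential])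
    fix t
    let ?z = "\<lambda>n. iexp (t * (\<rho> n * s n))"
    \<comment> \<open>The time is integer-valued, so its characteristic function is its generating
      function on the unit circle.\<close>
    have char: "char (distr (M n) borel (X n)) t = (\<integral>\<omega>. ?z n ^ reset_time n \<omega> \<partial>M n)" for n
    proof -
      have "iexp (t * X n \<omega>) = ?z n ^ reset_time n \<omega>" for \<omega>
        by (simp add: X_def exp_of_nat_mult[symmetric] mult_ac)
      then show ?thesis
        unfolding char_def using X by (subst integral_distr) auto
    qed
    have "(\<lambda>n. \<integral>\<omega>. ?z n ^ reset_time n \<omega> \<partial>M n) \<longlonglongrightarrow> 1 / (1 - \<i> * of_real t)"
    proof (rule char_limit_of_pgf_identity[OF rho s_pos])
      show "s \<longlonglongrightarrow> 0" unfolding s_def[abs_def] by (rule s_lim)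
      show "(\<lambda>n. \<rho> n * (1 - \<rho> n) * deriv (cc_pgf n (Pi n)) (1 - \<rho> n)) \<longlonglongrightarrow> 0" by (rule d_lim)
      fix n :: nat assume n: "n \<ge> 1"
      interpret reset_collector n "\<rho> n" "p n" "D n" "Pi n" by (rule rc[OF n])
      have z: "norm (?z n) \<le> 1" by simp
      show "norm (\<Phi> (?z n) - of_real (s n)) \<le> norm (1 - ?z n) * ((1 - \<rho> n) * deriv (cc_pgf n (Pi n)) (1 - \<rho> n))"
        using \<Phi>_diff_bound[OF z] by (simp only: d_def s_eq[OF n])
      show "(\<integral>\<omega>. ?z n ^ reset_time n \<omega> \<partial>M n) * (1 - ?z n + of_real (\<rho> n) * ?z n * \<Phi> (?z n)) =
          (1 - of_real (1 - \<rho> n) * ?z n) * \<Phi> (?z n)"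
        unfolding M_def by (rule reset_time_pgf[OF z])
    qed
    then show "(\<lambda>n. char (distr (M n) borel (X n)) t) \<longlonglongrightarrow> char (density lborel (exponential_density 1)) t"
      unfolding char char_exponential .
  qed
  have lim: "(\<lambda>n. measure (M n) {\<omega>\<in>space (M n). t < X n \<omega>}) \<longlonglongrightarrow> exp (- t)" if t: "0 \<le> t" for t
  proof -
    have "(\<lambda>n. 1 - cdf (distr (M n) borel (X n)) t) \<longlonglongrightarrow> 1 - (1 - exp (- t))"
      using weak isCont_cdf_exponential[of t]
      by (intro tendsto_diff tendsto_const) (auto simp: weak_conv_m_def weak_conv_def cdf_exponential[OF t])
    moreover have "1 - cdf (distr (M n) borel (X n)) t = measure (M n) {\<omega>\<in>space (M n). t < X n \<omega>}" for n
    proof -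
      interpret prob_space "M n" by (rule M)
      note X[of n, measurable]
      have "cdf (distr (M n) borel (X n)) t = prob {\<omega>\<in>space (M n). X n \<omega> \<le> t}"
        by (simp add: cdf_def measure_distr vimage_def Int_def conj_commute)
      also have "\<dots> = 1 - prob {\<omega>\<in>space (M n). \<not> X n \<omega> \<le> t}"
        by (subst prob_neg) auto
      finally show ?thesis by (simp add: not_le)
    qed
    ultimately show ?thesis by simp
  qed
  have moments: "(\<lambda>n. \<integral>\<omega>. X n \<omega> ^ Suc k \<partial>M n) \<longlonglongrightarrow> fact (Suc k)" for k
  proof (rule moments_tendsto_fact[OF M X _ lim])
    show "0 \<le> X n \<omega>" if "1 \<le> n" for n \<omega>
      using rho[OF that] s_pos[OF that] by (simp add: X_def)
    show "measure (M n) {\<omega>\<in>space (M n). t < X n \<omega>} \<le> 2 * exp (- (ln 2 / 2) * t)"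
      if "1 \<le> n" "0 \<le> t" for n t
      using reset_collector.tail_bound[OF rc[OF that(1)] that(2)]
      by (simp add: M_def X_def s_eq[OF that(1)])
  qed auto
  show ?thesis
  proof (intro conjI allI impI)
    show "weak_conv_m
           (\<lambda>n. distr (stream_space (measure_pmf (D n))) borel
                   (\<lambda>\<omega>. \<rho> n * cc_pgf n (Pi n) (1 - \<rho> n) * real (reset_time n \<omega>)))
           (density lborel (exponential_density 1))"
      using weak unfolding M_def X_def[abs_def] s_def .
    fix r :: nat assume "r \<ge> 1"
    then obtain k where "r = Suc k" by (cases r) auto
    then show "(\<lambda>n. \<integral>\<omega>. (\<rho> n * cc_pgf n (Pi n) (1 - \<rho> n) * real (reset_time n \<omega>)) ^ r
                    \<partial>stream_space (measure_pmf (D n))) \<longlonglongrightarrow> fact r"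
      using moments[of k] unfolding M_def X_def[abs_def] s_def by simp
  qed
qed

end
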